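(* Let $\mathcal{I}(n)$ denote the maximum CF-chromatic number $\chi_{\mathrm{cf}}(G)$ over all circle graphs $G$ on at most $n$ vertices. Then $\mathcal{I}(n)=\Theta(\log n)$.
   Context: A circle graph is the intersection graph of a finite family of chords of a circle (vertices are the chords, two adjacent iff the chords intersect); equivalently, the overlap graph of a finite family of intervals on a line (two intervals adjacent iff they intersect but neither contains the other). For a graph $G=(V,E)$ and $v\in V$, the punctured neighborhood is $N_G(v)=\{u\in V:\{u,v\}\in E\}$. A (punctured) conflict-free coloring (CF-coloring) of $G$ is a map $c:V\to\mathbb{N}$ such that for every vertex $v$ with $N_G(v)\neq\emptyset$ there is a color $i$ with $|N_G(v)\cap c^{-1}(i)|=1$ (vertices with empty neighborhood impose no condition). $\chi_{\mathrm{cf}}(G)$ is the minimum number of colors in a CF-coloring of $G$. *)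

theory Defs
  imports "HOL-Analysis.Analysis" "HOL-Library.Landau_Symbols"
begin

definition is_chord :: "complex \<Rightarrow> real \<Rightarrow> complex set \<Rightarrow> bool" where
  "is_chord z r C \<longleftrightarrow>
     (\<exists>p q. p \<in> sphere z r \<and> q \<in> sphere z r \<and> p \<noteq> q \<and> C = closed_segment p q)"

definition intersection_edges :: "'a set \<Rightarrow> ('a \<Rightarrow> 'b set) \<Rightarrow> 'a set set" where
  "intersection_edges V F =
     {{u, v} | u v. u \<in> V \<and> v \<in> V \<and> u \<noteq> v \<and> F u \<inter> F v \<noteq> {}}"

definition circle_graph :: "'a set \<Rightarrow> 'a set set \<Rightarrow> bool" where
  "circle_graph V E \<longleftrightarrow>
     finite V \<and>
     (\<exists>z r F. r > 0 \<and> (\<forall>v\<in>V. is_chord z r (F v)) \<and> E = intersection_edges V F)"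

definition punctured_nbhd :: "'a set \<Rightarrow> 'a set set \<Rightarrow> 'a \<Rightarrow> 'a set" where
  "punctured_nbhd V E v = {u \<in> V. {u, v} \<in> E}"

definition cf_coloring :: "'a set \<Rightarrow> 'a set set \<Rightarrow> ('a \<Rightarrow> nat) \<Rightarrow> bool" where
  "cf_coloring V E c \<longleftrightarrow>
     (\<forall>v\<in>V. punctured_nbhd V E v \<noteq> {} \<longrightarrow>
        (\<exists>i. card (punctured_nbhd V E v \<inter> c -` {i}) = 1))"

definition cf_chromatic :: "'a set \<Rightarrow> 'a set set \<Rightarrow> nat" where
  "cf_chromatic V E = (LEAST k. \<exists>c. cf_coloring V E c \<and> card (c ` V) = k)"

text \<open>
  Every finite graph is isomorphic to one whose vertices are natural numbers, so the maximum
  is taken over graphs of that kind. The set below is finite and nonempty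
  (\<open>finite_cf_values\<close>, \<open>cf_values_nonempty\<close>), hence \<open>Max\<close> is a genuine maximum, and
  it bounds circle graphs on any vertex type (\<open>cf_chromatic_le_max_cf_circle\<close>).
\<close>

definition max_cf_circle :: "nat \<Rightarrow> nat" where
  "max_cf_circle n =
     Max {cf_chromatic V E | (V :: nat set) E. circle_graph V E \<and> card V \<le> n}"

lemma cf_chromatic_le_card:
  assumes "finite V"
  shows "cf_chromatic V E \<le> card V"
proof -
  obtain c :: "'a \<Rightarrow> nat" where c: "inj_on c V"
    using assms finite_imp_inj_to_nat_seg by metis
  have "cf_coloring V E c"
    unfolding cf_coloring_def
  proof (intro ballI impI)
    fix v assume "punctured_nbhd V E v \<noteq> {}"
    then obtain u where u: "u \<in> punctured_nbhd V E v" by blast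
    have "punctured_nbhd V E v \<inter> c -` {c u} = {u}"
      using u c unfolding punctured_nbhd_def by (auto dest: inj_onD)
    then show "\<exists>i. card (punctured_nbhd V E v \<inter> c -` {i}) = 1"
      by (intro exI[of _ "c u"]) simp
  qed
  then show ?thesis
    unfolding cf_chromatic_def using card_image[OF c] by (intro Least_le) blast
qed

lemma finite_cf_values:
  "finite {cf_chromatic V E | (V :: nat set) E. circle_graph V E \<and> card V \<le> n}"
proof (rule finite_subset)
  show "{cf_chromatic V E | (V :: nat set) E. circle_graph V E \<and> card V \<le> n} \<subseteq> {..n}"
    by (auto simp: circle_graph_def intro: order_trans[OF cf_chromatic_le_card])
qed simp

lemma cf_values_nonempty:
  "{cf_chromatic V E | (V :: nat set) E. circle_graph V E \<and> card V \<le> n} \<noteq> {}"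
proof -
  have "circle_graph ({} :: nat set) {}"
    by (auto simp: circle_graph_def intersection_edges_def intro!: exI[of _ "1 :: real"])
  then show ?thesis by fastforce
qed

lemma cf_coloring_image:
  assumes f: "inj_on f V" and E: "\<And>e. e \<in> E \<Longrightarrow> e \<subseteq> V"
    and c: "cf_coloring (f ` V) ((`) f ` E) c"
  shows "cf_coloring V E (c \<circ> f)"
  unfolding cf_coloring_def
proof (intro ballI impI)
  fix v assume v: "v \<in> V" and ne: "punctured_nbhd V E v \<noteq> {}"
  have edge: "{f u, f v} \<in> (`) f ` E \<longleftrightarrow> {u, v} \<in> E" if "u \<in> V" for u
  proof
    assume "{f u, f v} \<in> (`) f ` E"
    then obtain e where e: "e \<in> E" "f ` {u, v} = f ` e" by auto
    then have "{u, v} = e"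
      using inj_on_image_eq_iff[OF f, of "{u, v}" e] E[OF e(1)] that v by simp
    with e show "{u, v} \<in> E" by simp
  qed (auto intro!: image_eqI[of _ _ "{u, v}"])
  have nb: "punctured_nbhd (f ` V) ((`) f ` E) (f v) = f ` punctured_nbhd V E v"
    unfolding punctured_nbhd_def using edge by auto
  then obtain i where i: "card (f ` punctured_nbhd V E v \<inter> c -` {i}) = 1"
    using c v ne unfolding cf_coloring_def by (metis image_eqI image_is_empty)
  have "f ` punctured_nbhd V E v \<inter> c -` {i} = f ` (punctured_nbhd V E v \<inter> (c \<circ> f) -` {i})"
    by auto
  moreover have "inj_on f (punctured_nbhd V E v \<inter> (c \<circ> f) -` {i})"
    using f by (rule inj_on_subset) (auto simp: punctured_nbhd_def)
  ultimately show "\<exists>i. card (punctured_nbhd V E v \<inter> (c \<circ> f) -` {i}) = 1"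
    using i card_image by metis
qed

lemma cf_chromatic_le_max_cf_circle:
  assumes G: "circle_graph V E" and n: "card V \<le> n"
  shows "cf_chromatic V E \<le> max_cf_circle n"
proof -
  obtain f :: "'a \<Rightarrow> nat" where f: "inj_on f V"
    using G finite_imp_inj_to_nat_seg unfolding circle_graph_def by metis
  obtain z r F where F: "r > 0" "\<forall>v\<in>V. is_chord z r (F v)" "E = intersection_edges V F"
    using G unfolding circle_graph_def by blast
  define g where "g = inv_into V f"
  have g: "g (f v) = v" if "v \<in> V" for v
    using f that by (simp add: g_def)
  have EV: "e \<subseteq> V" if "e \<in> E" for e
    using that F(3) unfolding intersection_edges_def by auto
  have "(`) f ` E = intersection_edges (f ` V) (F \<circ> g)"
  proof (intro equalityI subsetI)
    fix e assume "e \<in> (`) f ` E"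
    then obtain u v where "e = {f u, f v}" "u \<in> V" "v \<in> V" "u \<noteq> v" "F u \<inter> F v \<noteq> {}"
      unfolding F(3) intersection_edges_def by auto
    then show "e \<in> intersection_edges (f ` V) (F \<circ> g)"
      unfolding intersection_edges_def
      by (intro CollectI exI[of _ "f u"] exI[of _ "f v"]) (auto simp: g inj_on_eq_iff[OF f])
  next
    fix e assume "e \<in> intersection_edges (f ` V) (F \<circ> g)"
    then obtain u v where uv: "e = {f u, f v}" "u \<in> V" "v \<in> V" "f u \<noteq> f v"
        "F u \<inter> F v \<noteq> {}"
      unfolding intersection_edges_def by (auto simp: g) blast
    then have "{u, v} \<in> E" unfolding F(3) intersection_edges_def by auto
    then show "e \<in> (`) f ` E" using uv by (auto intro!: image_eqI[of _ _ "{u, v}"])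
  qed
  moreover have "finite (f ` V)" "\<forall>v\<in>f ` V. is_chord z r ((F \<circ> g) v)"
    using G F(2) by (auto simp: g circle_graph_def)
  ultimately have G': "circle_graph (f ` V) ((`) f ` E)"
    using F(1) unfolding circle_graph_def by blast
  have "\<exists>k c. cf_coloring (f ` V) ((`) f ` E) c \<and> card (c ` f ` V) = k"
  proof -
    have "cf_coloring (f ` V) ((`) f ` E) id"
      unfolding cf_coloring_def
    proof (intro ballI impI)
      fix v assume "punctured_nbhd (f ` V) ((`) f ` E) v \<noteq> {}"
      then obtain u where "u \<in> punctured_nbhd (f ` V) ((`) f ` E) v" by blast
      then have "punctured_nbhd (f ` V) ((`) f ` E) v \<inter> id -` {u} = {u}" by auto
      then show "\<exists>i. card (punctured_nbhd (f ` V) ((`) f ` E) v \<inter> id -` {i}) = 1"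
        by (intro exI[of _ u]) simp
    qed
    then show ?thesis by blast
  qed
  from LeastI_ex[OF this] obtain c where c: "cf_coloring (f ` V) ((`) f ` E) c"
      "card (c ` f ` V) = cf_chromatic (f ` V) ((`) f ` E)"
    unfolding cf_chromatic_def by blast
  have "cf_chromatic V E \<le> card ((c \<circ> f) ` V)"
    using cf_coloring_image[OF f EV c(1)] unfolding cf_chromatic_def
    by (intro Least_le) blast
  also have "\<dots> = cf_chromatic (f ` V) ((`) f ` E)"
    using c(2) by (simp add: image_comp)
  also have "\<dots> \<le> max_cf_circle n"
    unfolding max_cf_circle_def using G' n card_image[OF f]
    by (intro Max_ge finite_cf_values) force
  finally show ?thesis .
qed

end

theory Submission
  imports Defs
begin

text \<open>
  Cutting the circle at a point that is no endpoint turns chords into intervals, two chords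
  meeting iff their intervals overlap (with shared endpoints counted as overlap).

  Lower bound: take \<open>2\<^sup>k\<close> nested intervals, whose right endpoints are the points
  \<open>0, \<dots>, 2\<^sup>k - 1\<close>, and one interval around every dyadic block of these points. The block
  intervals do not overlap each other, so each one sees exactly its points. The point whose colour
  is unique in the largest block lies in one half, and the other half misses that colour; hence
  every level of the dyadic tree costs a new colour.

  Upper bound: in each component let the root be the interval with the leftmost left endpoint, and
  split the component into breadth-first layers, coloured with three palettes cyclically. If \<open>v\<close>
  lies in layer \<open>i + 1\<close>, the layers before \<open>i\<close> are connected, miss \<open>v\<close> and contain the root, so
  they stay outside \<open>v\<close>; therefore no interval of layer \<open>i\<close> lies inside \<open>v\<close>, and the neighbours
  of \<open>v\<close> in layer \<open>i\<close> are those with an endpoint in \<open>v\<close>. It remains to colour a family of intervals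
  so that, for every query interval, some colour is unique among the members with an endpoint in
  it. Joining members that own consecutive endpoints gives a graph of degree at most 4, which has
  an independent set containing a fifth of its vertices; give this set a colour of its own and
  recurse on the rest.
\<close>

section \<open>Chords and overlapping intervals\<close>

definition overlap :: "real \<Rightarrow> real \<Rightarrow> real \<Rightarrow> real \<Rightarrow> bool" where
  "overlap a b c d \<longleftrightarrow> a \<le> c \<and> c \<le> b \<and> b \<le> d \<or> c \<le> a \<and> a \<le> d \<and> d \<le> b"

definition overlap_edges :: "'a set \<Rightarrow> ('a \<Rightarrow> real) \<Rightarrow> ('a \<Rightarrow> real) \<Rightarrow> 'a set set" where
  "overlap_edges V l r =
     {{u, v} | u v. u \<in> V \<and> v \<in> V \<and> u \<noteq> v \<and> overlap (l u) (r u) (l v) (r v)}"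

lemma overlap_sym: "overlap a b c d \<longleftrightarrow> overlap c d a b"
  unfolding overlap_def by blast

lemma overlap_edges_iff:
  "{u, v} \<in> overlap_edges V l r \<longleftrightarrow>
     u \<in> V \<and> v \<in> V \<and> u \<noteq> v \<and> overlap (l u) (r u) (l v) (r v)"
  unfolding overlap_edges_def using overlap_sym by (auto simp: doubleton_eq_iff)

text \<open>Inverse stereographic projection from \<open>-1\<close>.\<close>

definition circle_pt :: "real \<Rightarrow> complex" where
  "circle_pt t = Complex ((1 - t\<^sup>2) / (1 + t\<^sup>2)) (2 * t / (1 + t\<^sup>2))"

lemma one_plus_square_pos: "1 + (t::real)\<^sup>2 > 0"
  by (simp add: add_pos_nonneg)

lemma norm_circle_pt: "norm (circle_pt t) = 1"
proof -
  have "(1 - t\<^sup>2)\<^sup>2 + (2 * t)\<^sup>2 = (1 + t\<^sup>2)\<^sup>2" by algebra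
  moreover have "1 + t\<^sup>2 \<noteq> 0" using one_plus_square_pos[of t] by linarith
  ultimately have "((1 - t\<^sup>2) / (1 + t\<^sup>2))\<^sup>2 + (2 * t / (1 + t\<^sup>2))\<^sup>2 = 1"
    by (simp add: power_divide flip: add_divide_distrib)
  then show ?thesis by (simp add: circle_pt_def cmod_def)
qed

text \<open>The parameter is the slope of the line from -1 to \<open>q\<close>.\<close>

lemma circle_pt_surj:
  assumes "norm q = 1" "q \<noteq> -1"
  shows "circle_pt (Im q / (1 + Re q)) = q"
proof -
  have 1: "(Re q)\<^sup>2 + (Im q)\<^sup>2 = 1" using assms(1) by (simp add: cmod_def)
  have 2: "1 + Re q \<noteq> 0"
  proof
    assume "1 + Re q = 0"
    then have "Re q = -1" by simp
    moreover from this 1 have "Im q = 0" by simp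
    ultimately show False using assms(2) by (simp add: complex_eq_iff)
  qed
  define x y where "x = Re q" and "y = Im q"
  have xy: "x\<^sup>2 + y\<^sup>2 = 1" "1 + x \<noteq> 0" using 1 2 by (simp_all add: x_def y_def)
  have A: "1 + (y / (1 + x))\<^sup>2 = 2 / (1 + x)"
  proof -
    have "(1 + x)\<^sup>2 + y\<^sup>2 = 2 * (1 + x)" using xy(1) by algebra
    then have "((1 + x)\<^sup>2 + y\<^sup>2) / (1 + x)\<^sup>2 = 2 * (1 + x) / ((1 + x) * (1 + x))"
      by (simp only: power2_eq_square)
    also have "\<dots> = 2 / (1 + x)" using xy(2) by (rule mult_divide_mult_cancel_right)
    finally have "((1 + x)\<^sup>2 + y\<^sup>2) / (1 + x)\<^sup>2 = 2 / (1 + x)" .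
    then show ?thesis using xy(2) by (simp add: add_divide_distrib power_divide)
  qed
  have B: "1 - (y / (1 + x))\<^sup>2 = 2 * x / (1 + x)"
  proof -
    have "1 - (y / (1 + x))\<^sup>2 = 2 - 2 / (1 + x)" using A by linarith
    also have "\<dots> = 2 * x / (1 + x)" using xy(2) by (simp add: field_simps)
    finally show ?thesis .
  qed
  have "(1 - (y / (1 + x))\<^sup>2) / (1 + (y / (1 + x))\<^sup>2) = x"
    "2 * (y / (1 + x)) / (1 + (y / (1 + x))\<^sup>2) = y"
    unfolding A B using xy(2) by (simp_all add: field_simps)
  then show ?thesis by (simp add: circle_pt_def complex_eq_iff x_def y_def)
qed

lemma inj_circle_pt: "inj circle_pt"
proof (rule injI)
  have *: "Im (circle_pt t) / (1 + Re (circle_pt t)) = t" for t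
  proof -
    have "1 + Re (circle_pt t) = 2 / (1 + t\<^sup>2)"
      using one_plus_square_pos[of t] by (simp add: circle_pt_def field_simps)
    moreover have "Im (circle_pt t) = t * (2 / (1 + t\<^sup>2))"
      by (simp add: circle_pt_def)
    moreover have "2 / (1 + t\<^sup>2) \<noteq> 0" using one_plus_square_pos[of t] by simp
    ultimately show ?thesis by (metis nonzero_mult_div_cancel_right)
  qed
  show "s = t" if "circle_pt s = circle_pt t" for s t
    using *[of s] *[of t] that by metis
qed

text \<open>An affine functional vanishing on the line through the points with parameters
  \<open>a\<close> and \<open>b\<close>; on the circle its sign is that of \<open>(t - a) * (t - b)\<close>.\<close>

definition secant :: "real \<Rightarrow> real \<Rightarrow> complex \<Rightarrow> real" where
  "secant a b w = (1 - Re w) - (a + b) * Im w + a * b * (1 + Re w)"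

lemma secant_circle_pt: "secant a b (circle_pt t) = 2 * ((t - a) * (t - b)) / (1 + t\<^sup>2)"
proof -
  have "1 - Re (circle_pt t) = 2 * t\<^sup>2 / (1 + t\<^sup>2)" "1 + Re (circle_pt t) = 2 / (1 + t\<^sup>2)"
    "Im (circle_pt t) = 2 * t / (1 + t\<^sup>2)"
    using one_plus_square_pos[of t] by (simp_all add: circle_pt_def field_simps)
  then have "secant a b (circle_pt t) =
      2 * t\<^sup>2 / (1 + t\<^sup>2) - (a + b) * (2 * t / (1 + t\<^sup>2)) + a * b * (2 / (1 + t\<^sup>2))"
    unfolding secant_def by simp
  also have "\<dots> = (2 * t\<^sup>2 - (a + b) * (2 * t) + a * b * 2) / (1 + t\<^sup>2)"
    by (simp add: add_divide_distrib diff_divide_distrib)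
  also have "2 * t\<^sup>2 - (a + b) * (2 * t) + a * b * 2 = 2 * ((t - a) * (t - b))"
    by algebra
  finally show ?thesis .
qed

lemma secant_convex_comb:
  "secant a b ((1 - u) *\<^sub>R p + u *\<^sub>R q) = (1 - u) * secant a b p + u * secant a b q"
  unfolding secant_def by (simp add: algebra_simps)

text \<open>\<open>secant a b\<close> vanishes on the first chord. The hypothesis gives it the same
  strict sign at the points of \<open>c\<close> and \<open>d\<close>; being affine, it keeps that
  sign on their chord.\<close>

lemma disjoint_segments_if_same_side:
  assumes "(c - a) * (c - b) * ((d - a) * (d - b)) > 0"
  shows "closed_segment (circle_pt a) (circle_pt b) \<inter>
    closed_segment (circle_pt c) (circle_pt d) = {}"
proof -
  have 0: "secant a b w = 0" if "w \<in> closed_segment (circle_pt a) (circle_pt b)" for w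
    using that unfolding in_segment by (auto simp: secant_convex_comb secant_circle_pt)
  have "secant a b w \<noteq> 0" if w: "w \<in> closed_segment (circle_pt c) (circle_pt d)" for w
  proof -
    obtain u where u: "0 \<le> u" "u \<le> 1" "w = (1 - u) *\<^sub>R circle_pt c + u *\<^sub>R circle_pt d"
      using w unfolding in_segment by blast
    let ?x = "secant a b (circle_pt c)" and ?y = "secant a b (circle_pt d)"
    have "?x * ?y = 4 * ((c - a) * (c - b) * ((d - a) * (d - b))) / ((1 + c\<^sup>2) * (1 + d\<^sup>2))"
      by (simp add: secant_circle_pt)
    also have "\<dots> > 0"
      using assms one_plus_square_pos[of c] one_plus_square_pos[of d]
      by (intro divide_pos_pos mult_pos_pos[of 4] mult_pos_pos[of "1 + _"]) simp_all
    finally have "?x > 0 \<and> ?y > 0 \<or> ?x < 0 \<and> ?y < 0"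
      by (simp only: zero_less_mult_iff)
    then have "(1 - u) * ?x + u * ?y \<noteq> 0"
    proof
      assume "?x > 0 \<and> ?y > 0"
      then have "(1 - u) * ?x + u * ?y > 0"
        using u(1,2) by (cases "u = 0") (auto intro: add_nonneg_pos)
      then show ?thesis by simp
    next
      assume "?x < 0 \<and> ?y < 0"
      then have "(1 - u) * ?x + u * ?y < 0"
        using u(1,2) by (cases "u = 0")
          (auto intro: add_nonpos_neg simp: mult_nonneg_nonpos mult_pos_neg)
      then show ?thesis by simp
    qed
    then show ?thesis by (simp add: u(3) secant_convex_comb)
  qed
  with 0 show ?thesis by blast
qed

lemma weighted_mean_in_segment:
  fixes p q :: complex
  assumes "s \<ge> 0" "t \<ge> 0" "s + t > 0"
  shows "(s *\<^sub>R p + t *\<^sub>R q) /\<^sub>R (s + t) \<in> closed_segment p q"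
proof -
  have "1 - t / (s + t) = s / (s + t)" using assms by (simp add: field_simps)
  then have "(s *\<^sub>R p + t *\<^sub>R q) /\<^sub>R (s + t) = (1 - t / (s + t)) *\<^sub>R p + (t / (s + t)) *\<^sub>R q"
    by (simp add: scaleR_add_right divide_inverse mult.commute)
  moreover have "0 \<le> t / (s + t)" "t / (s + t) \<le> 1" using assms by (simp_all add: field_simps)
  ultimately show ?thesis unfolding in_segment by blast
qed

text \<open>The weights are those of the linear dependence of four points on the curve
  \<open>(1, t, t\<^sup>2)\<close>, cleared of denominators.\<close>

lemma segments_meet_if_interleaved:
  assumes "a < c" "c < b" "b < d"
  shows "closed_segment (circle_pt a) (circle_pt b) \<inter>
    closed_segment (circle_pt c) (circle_pt d) \<noteq> {}"
proof -
  define \<alpha> \<beta> \<gamma> \<delta> where "\<alpha> = (b - c) * (d - b) * (d - c)" and "\<beta> = (c - a) * (d - a) * (d - c)"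
    and "\<gamma> = (b - a) * (d - a) * (d - b)" and "\<delta> = (b - a) * (c - a) * (b - c)"
  note w = \<alpha>_def \<beta>_def \<gamma>_def \<delta>_def
  have pos: "\<alpha> > 0" "\<beta> > 0" "\<gamma> > 0" "\<delta> > 0" using assms by (simp_all add: w)
  have e0: "\<alpha> + \<beta> = \<gamma> + \<delta>" unfolding w by algebra
  have e1: "\<alpha> * a + \<beta> * b = \<gamma> * c + \<delta> * d" unfolding w by algebra
  have e2: "\<alpha> * a\<^sup>2 + \<beta> * b\<^sup>2 = \<gamma> * c\<^sup>2 + \<delta> * d\<^sup>2" unfolding w by algebra
  \<comment> \<open>Scaled by \<open>1 + t\<^sup>2\<close>, a point of the circle has coordinates
    quadratic in \<open>t\<close>. So by \<open>e0\<close>, \<open>e1\<close>, \<open>e2\<close>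
    both pairs have the same total weight and weighted sum, and their common mean lies on both
    chords.\<close>
  have pt: "(k * (1 + t\<^sup>2)) *\<^sub>R circle_pt t = Complex (k * (1 - t\<^sup>2)) (k * (2 * t))" for k t
    using one_plus_square_pos[of t] by (simp add: circle_pt_def complex_eq_iff)
  let ?s = "\<lambda>k t. k * (1 + t\<^sup>2)"
  have sum: "?s \<alpha> a + ?s \<beta> b = ?s \<gamma> c + ?s \<delta> d" using e0 e2 by (simp add: algebra_simps)
  have "?s \<alpha> a *\<^sub>R circle_pt a + ?s \<beta> b *\<^sub>R circle_pt b =
    ?s \<gamma> c *\<^sub>R circle_pt c + ?s \<delta> d *\<^sub>R circle_pt d"
    unfolding pt using e0 e1 e2 by (simp add: complex_eq_iff algebra_simps)
  then have eq: "(?s \<alpha> a *\<^sub>R circle_pt a + ?s \<beta> b *\<^sub>R circle_pt b) /\<^sub>R (?s \<alpha> a + ?s \<beta> b) =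
    (?s \<gamma> c *\<^sub>R circle_pt c + ?s \<delta> d *\<^sub>R circle_pt d) /\<^sub>R (?s \<gamma> c + ?s \<delta> d)"
    using sum by simp
  have spos: "?s k t > 0" if "k > 0" for k t :: real
    using that one_plus_square_pos[of t] by simp
  have "(?s \<alpha> a *\<^sub>R circle_pt a + ?s \<beta> b *\<^sub>R circle_pt b) /\<^sub>R (?s \<alpha> a + ?s \<beta> b)
      \<in> closed_segment (circle_pt a) (circle_pt b)"
    using spos pos by (intro weighted_mean_in_segment) (auto intro: add_pos_pos less_imp_le)
  moreover have "(?s \<gamma> c *\<^sub>R circle_pt c + ?s \<delta> d *\<^sub>R circle_pt d) /\<^sub>R (?s \<gamma> c + ?s \<delta> d)
      \<in> closed_segment (circle_pt c) (circle_pt d)"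
    using spos pos by (intro weighted_mean_in_segment) (auto intro: add_pos_pos less_imp_le)
  ultimately show ?thesis unfolding eq by blast
qed

lemma segments_meet_iff_overlap:
  assumes "a < b" "c < d"
  shows "closed_segment (circle_pt a) (circle_pt b) \<inter>
    closed_segment (circle_pt c) (circle_pt d) \<noteq> {} \<longleftrightarrow> overlap a b c d"
proof
  assume meet: "closed_segment (circle_pt a) (circle_pt b) \<inter>
    closed_segment (circle_pt c) (circle_pt d) \<noteq> {}"
  show "overlap a b c d"
  proof (rule ccontr)
    assume "\<not> overlap a b c d"
    then consider "b < c" | "d < a" | "a < c" "d < b" | "c < a" "b < d"
      unfolding overlap_def by linarith
    then have "(c - a) * (c - b) * ((d - a) * (d - b)) > 0"
      using assms by cases (auto simp: zero_less_mult_iff mult_less_0_iff)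
    with disjoint_segments_if_same_side meet show False by blast
  qed
next
  assume ov: "overlap a b c d"
  show "closed_segment (circle_pt a) (circle_pt b) \<inter>
    closed_segment (circle_pt c) (circle_pt d) \<noteq> {}"
  proof (cases "a = c \<or> a = d \<or> b = c \<or> b = d")
    case True
    then show ?thesis using ends_in_segment by blast
  next
    case False
    with ov consider "a < c" "c < b" "b < d" | "c < a" "a < d" "d < b"
      unfolding overlap_def by force
    then show ?thesis
      using segments_meet_if_interleaved[of a c b d] segments_meet_if_interleaved[of c a d b]
      by cases blast+
  qed
qed

text \<open>Carries the unit circle to an arbitrary one; the argument of \<open>k\<close> stays
  free, so any point of the circle can become the cut point.\<close>

lemma affine_segments_meet_iff:
  fixes k z p q p' q' :: complex
  assumes "k \<noteq> 0"
  shows "closed_segment (z + k * p) (z + k * q) \<inter> closed_segment (z + k * p') (z + k * q') \<noteq> {}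
    \<longleftrightarrow> closed_segment p q \<inter> closed_segment p' q' \<noteq> {}"
proof -
  have img: "closed_segment (z + k * p) (z + k * q) = (\<lambda>x. z + k * x) ` closed_segment p q" for p q
  proof -
    have "closed_segment (z + k * p) (z + k * q) = (+) z ` closed_segment (k * p) (k * q)"
      by (rule closed_segment_translation)
    also have "closed_segment (k * p) (k * q) = (*) k ` closed_segment p q"
      by (rule closed_segment_linear_image) (rule bounded_linear.linear[OF bounded_linear_mult_right])
    finally show ?thesis by (simp add: image_image)
  qed
  have "inj (\<lambda>x. z + k * x)" using assms by (auto intro: injI)
  then show ?thesis unfolding img by (simp flip: image_Int)
qed

section \<open>Circle graphs as overlap graphs of intervals\<close>

lemma circle_graph_overlap_edges:
  assumes "finite V" "\<And>v. v \<in> V \<Longrightarrow> l v < r v"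
  shows "circle_graph V (overlap_edges V l r)"
proof -
  let ?F = "\<lambda>v. closed_segment (circle_pt (l v)) (circle_pt (r v))"
  have "is_chord 0 1 (?F v)" if "v \<in> V" for v
    unfolding is_chord_def using assms(2)[OF that] inj_circle_pt
    by (intro exI[of _ "circle_pt (l v)"] exI[of _ "circle_pt (r v)"])
      (auto simp: norm_circle_pt dest: injD)
  moreover have "?F u \<inter> ?F v \<noteq> {} \<longleftrightarrow> overlap (l u) (r u) (l v) (r v)"
    if "u \<in> V" "v \<in> V" for u v
    by (rule segments_meet_iff_overlap[OF assms(2)[OF that(1)] assms(2)[OF that(2)]])
  then have "overlap_edges V l r = intersection_edges V ?F"
    unfolding overlap_edges_def intersection_edges_def by blast
  ultimately show ?thesis
    unfolding circle_graph_def using assms(1)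
    by (intro conjI exI[of _ 0] exI[of _ 1] exI[of _ ?F]) auto
qed

lemma circle_graph_imp_overlap_edges:
  assumes "circle_graph V E"
  obtains l r where "\<And>v. v \<in> V \<Longrightarrow> l v < r v" "E = overlap_edges V l r"
proof -
  obtain z R F where V: "finite V" and R: "R > 0" and F: "\<And>v. v \<in> V \<Longrightarrow> is_chord z R (F v)"
      and E: "E = intersection_edges V F"
    using assms unfolding circle_graph_def by blast
  have "\<forall>v\<in>V. \<exists>p q. p \<in> sphere z R \<and> q \<in> sphere z R \<and> p \<noteq> q \<and> F v = closed_segment p q"
    using F unfolding is_chord_def by blast
  then obtain p q where pq: "\<And>v. v \<in> V \<Longrightarrow>
      p v \<in> sphere z R \<and> q v \<in> sphere z R \<and> p v \<noteq> q v \<and> F v = closed_segment (p v) (q v)"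
    by metis
  \<comment> \<open>Infinitely many points against finitely many endpoints leave a point for the
    cut.\<close>
  have "infinite (range (\<lambda>t. z + of_real R * circle_pt t))"
    using R inj_circle_pt infinite_UNIV_char_0 by (subst finite_image_iff) (auto simp: inj_def)
  moreover have "finite (p ` V \<union> q ` V)" using V by simp
  ultimately obtain t0 where t0: "z + of_real R * circle_pt t0 \<notin> p ` V \<union> q ` V"
    by (meson finite_subset image_subsetI)
  \<comment> \<open>Mapping \<open>w\<close> to \<open>z + k * w\<close> sends -1, the point that
    \<open>circle_pt\<close> omits, to the cut point.\<close>
  define k where "k = - of_real R * circle_pt t0"
  have k: "norm k = R" using R by (simp add: k_def norm_mult norm_circle_pt)
  then have k0: "k \<noteq> 0" using R by auto
  define T where "T x = Im ((x - z) / k) / (1 + Re ((x - z) / k))" for x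
  have T: "z + k * circle_pt (T x) = x" if "x \<in> sphere z R" "x \<in> p ` V \<union> q ` V" for x
  proof -
    have "norm ((x - z) / k) = 1"
      using that(1) k R by (simp add: norm_divide dist_norm norm_minus_commute)
    moreover have "(x - z) / k \<noteq> -1"
    proof
      assume "(x - z) / k = -1"
      then have "x = z - k" using k0 by (simp add: field_simps)
      then show False using t0 that(2) by (simp add: k_def)
    qed
    ultimately have "circle_pt (T x) = (x - z) / k" unfolding T_def by (rule circle_pt_surj)
    then show ?thesis using k0 by simp
  qed
  define l r where "l v = min (T (p v)) (T (q v))" and "r v = max (T (p v)) (T (q v))" for v
  have Tp: "z + k * circle_pt (T (p v)) = p v" and Tq: "z + k * circle_pt (T (q v)) = q v"
    if "v \<in> V" for v
    using T pq that by auto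
  have lr: "l v < r v" if "v \<in> V" for v
  proof -
    have "T (p v) \<noteq> T (q v)" using Tp[OF that] Tq[OF that] pq[OF that] by metis
    then show ?thesis by (auto simp: l_def r_def)
  qed
  have Fv: "F v = closed_segment (z + k * circle_pt (l v)) (z + k * circle_pt (r v))"
    if "v \<in> V" for v
    using pq[OF that] Tp[OF that] Tq[OF that]
    by (auto simp: l_def r_def min_def max_def closed_segment_commute)
  have "F u \<inter> F v \<noteq> {} \<longleftrightarrow> overlap (l u) (r u) (l v) (r v)" if "u \<in> V" "v \<in> V" for u v
    unfolding Fv[OF that(1)] Fv[OF that(2)] affine_segments_meet_iff[OF k0]
    by (rule segments_meet_iff_overlap[OF lr[OF that(1)] lr[OF that(2)]])
  then have "E = overlap_edges V l r"
    unfolding E overlap_edges_def intersection_edges_def by blast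
  with lr that show ?thesis by blast
qed

section \<open>The lower bound\<close>

text \<open>An injective colouring is conflict-free, so \<open>LEAST\<close> is attained.\<close>

lemma cf_coloring_attains_chromatic:
  assumes "finite V"
  shows "\<exists>c. cf_coloring V E c \<and> card (c ` V) = cf_chromatic V E"
proof -
  obtain c :: "'a \<Rightarrow> nat" where c: "inj_on c V"
    using assms finite_imp_inj_to_nat_seg by metis
  have "\<exists>i. card (punctured_nbhd V E v \<inter> c -` {i}) = 1" if ne: "punctured_nbhd V E v \<noteq> {}" for v
  proof -
    obtain u where "u \<in> punctured_nbhd V E v" using ne by blast
    then have "punctured_nbhd V E v \<inter> c -` {c u} = {u}"
      using c unfolding punctured_nbhd_def by (auto dest: inj_onD)
    then show ?thesis by (intro exI[of _ "c u"]) simp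
  qed
  then have "cf_coloring V E c" unfolding cf_coloring_def by blast
  then have "\<exists>k c. cf_coloring V E c \<and> card (c ` V) = k" by blast
  from LeastI_ex[OF this] show ?thesis unfolding cf_chromatic_def .
qed

text \<open>The pair \<open>(b, t)\<close> encodes the block \<open>{t..<t + 2 ^ b}\<close>; its
  level \<open>b\<close> will determine the margin of its interval.\<close>

fun dyadic_blocks :: "nat \<Rightarrow> nat \<Rightarrow> (nat \<times> nat) set" where
  "dyadic_blocks 0 s = {(0, s)}"
| "dyadic_blocks (Suc a) s =
     insert (Suc a, s) (dyadic_blocks a s \<union> dyadic_blocks a (s + 2 ^ a))"

lemma finite_dyadic_blocks: "finite (dyadic_blocks a s)"
  by (induction a arbitrary: s) auto

text \<open>A full binary tree of height \<open>a\<close> has \<open>2 ^ Suc a - 1\<close> nodes.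
  With \<open>2 ^ k\<close> points this stays below \<open>3 * 2 ^ k\<close> vertices.\<close>

lemma card_dyadic_blocks: "card (dyadic_blocks a s) < 2 ^ Suc a"
proof (induction a arbitrary: s)
  case (Suc a)
  have "card (dyadic_blocks (Suc a) s) \<le>
      Suc (card (dyadic_blocks a s \<union> dyadic_blocks a (s + 2 ^ a)))"
    by (simp add: card_insert_le_m1 finite_dyadic_blocks card_insert_if)
  also have "\<dots> \<le> Suc (card (dyadic_blocks a s) + card (dyadic_blocks a (s + 2 ^ a)))"
    using card_Un_le by simp
  also have "\<dots> < 2 ^ Suc (Suc a)"
    using Suc.IH[of s] Suc.IH[of "s + 2 ^ a"] by simp
  finally show ?case .
qed simp

lemma dyadic_blocks_bounds:
  "(b, t) \<in> dyadic_blocks a s \<Longrightarrow> b \<le> a \<and> s \<le> t \<and> t + 2 ^ b \<le> s + 2 ^ a"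
proof (induction a arbitrary: s)
  case (Suc a)
  then consider "(b, t) = (Suc a, s)" | "(b, t) \<in> dyadic_blocks a s"
    | "(b, t) \<in> dyadic_blocks a (s + 2 ^ a)" by auto
  then show ?case
  proof cases
    case 2
    then show ?thesis using Suc.IH[of s] by simp
  next
    case 3
    then show ?thesis using Suc.IH[of "s + 2 ^ a"] by simp
  qed simp
qed simp

lemma dyadic_blocks_top: "(a, s) \<in> dyadic_blocks a s"
  by (cases a) auto

text \<open>Blocks in the same half are handled by induction, those in different halves are
  disjoint, and the top block contains all others. Strictness of the levels later makes the margins
  of nested blocks differ.\<close>

lemma dyadic_blocks_laminar:
  assumes "(b, t) \<in> dyadic_blocks a s" "(b', t') \<in> dyadic_blocks a s" "(b, t) \<noteq> (b', t')"
  shows "t + 2 ^ b \<le> t' \<or> t' + 2 ^ b' \<le> t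
    \<or> b < b' \<and> t' \<le> t \<and> t + 2 ^ b \<le> t' + 2 ^ b'
    \<or> b' < b \<and> t \<le> t' \<and> t' + 2 ^ b' \<le> t + 2 ^ b"
  using assms
proof (induction a arbitrary: s)
  case (Suc a)
  have top: "v < Suc a \<and> s \<le> w \<and> w + 2 ^ v \<le> s + 2 ^ Suc a"
    if "(v, w) \<in> dyadic_blocks a s \<union> dyadic_blocks a (s + 2 ^ a)" for v w
  proof (cases "(v, w) \<in> dyadic_blocks a s")
    case True
    then show ?thesis using dyadic_blocks_bounds[of v w a s] by simp
  next
    case False
    then show ?thesis using that dyadic_blocks_bounds[of v w a "s + 2 ^ a"] by simp
  qed
  have split: "w + 2 ^ v \<le> w'"
    if "(v, w) \<in> dyadic_blocks a s" "(v', w') \<in> dyadic_blocks a (s + 2 ^ a)" for v w v' w'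
    using dyadic_blocks_bounds[OF that(1)] dyadic_blocks_bounds[OF that(2)] by linarith
  consider "(b, t) = (Suc a, s)" | "(b', t') = (Suc a, s)"
    | "(b, t) \<in> dyadic_blocks a s" "(b', t') \<in> dyadic_blocks a s"
    | "(b, t) \<in> dyadic_blocks a (s + 2 ^ a)" "(b', t') \<in> dyadic_blocks a (s + 2 ^ a)"
    | "(b, t) \<in> dyadic_blocks a s" "(b', t') \<in> dyadic_blocks a (s + 2 ^ a)"
    | "(b, t) \<in> dyadic_blocks a (s + 2 ^ a)" "(b', t') \<in> dyadic_blocks a s"
    using Suc.prems by auto
  then show ?case
  proof cases
    case 1
    then have "(b', t') \<in> dyadic_blocks a s \<union> dyadic_blocks a (s + 2 ^ a)"
      using Suc.prems by auto
    with top 1 show ?thesis by blast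
  next
    case 2
    then have "(b, t) \<in> dyadic_blocks a s \<union> dyadic_blocks a (s + 2 ^ a)"
      using Suc.prems by auto
    with top 2 show ?thesis by blast
  next
    case 3
    then show ?thesis using Suc.IH Suc.prems(3) by blast
  next
    case 4
    then show ?thesis using Suc.IH Suc.prems(3) by blast
  next
    case 5
    then show ?thesis using split by blast
  next
    case 6
    then show ?thesis using split by blast
  qed
qed auto

lemma dyadic_coloring_many_colors:
  fixes c :: "nat \<Rightarrow> nat"
  assumes "\<And>b t. (b, t) \<in> dyadic_blocks a s \<Longrightarrow> \<exists>i. card ({t..<t + 2 ^ b} \<inter> c -` {i}) = 1"
  shows "a < card (c ` {s..<s + 2 ^ a})"
  using assms
proof (induction a arbitrary: s)
  case 0
  then show ?case by simp
next
  case (Suc a)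
  let ?L = "{s..<s + 2 ^ a}" and ?R = "{s + 2 ^ a..<s + 2 ^ a + 2 ^ a}"
  have LR: "{s..<s + 2 ^ Suc a} = ?L \<union> ?R" by auto
  have IH: "a < card (c ` ?L)" "a < card (c ` ?R)"
    using Suc.prems by (auto intro!: Suc.IH)
  obtain i where "card ({s..<s + 2 ^ Suc a} \<inter> c -` {i}) = 1"
    using Suc.prems[OF dyadic_blocks_top] by blast
  then obtain x where x: "{s..<s + 2 ^ Suc a} \<inter> c -` {i} = {x}"
    using card_1_singletonE by metis
  have "\<exists>H. H \<subseteq> {s..<s + 2 ^ Suc a} \<and> x \<notin> H \<and> a < card (c ` H)"
  proof (cases "x \<in> ?L")
    case True
    then have "x \<notin> ?R" by simp
    with IH LR show ?thesis by blast
  next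
    case False
    with IH LR show ?thesis by blast
  qed
  then obtain H where H: "H \<subseteq> {s..<s + 2 ^ Suc a}" "x \<notin> H" "a < card (c ` H)" by blast
  have fin: "finite H" using H(1) finite_subset by blast
  have "i \<notin> c ` H"
  proof
    assume "i \<in> c ` H"
    then obtain h where "h \<in> H" "c h = i" by blast
    then have "h \<in> {s..<s + 2 ^ Suc a} \<inter> c -` {i}" using H(1) by blast
    then show False unfolding x using \<open>h \<in> H\<close> H(2) by simp
  qed
  then have "Suc a < card (insert i (c ` H))" using H(3) fin by simp
  also have "\<dots> \<le> card (c ` {s..<s + 2 ^ Suc a})"
    using H(1) x by (intro card_mono) auto
  finally show ?case .
qed

text \<open>The intervals of the points \<open>i\<close> are nested, and right of \<open>-1\<close> they only have their right
  endpoint \<open>i\<close>. A block is an interval slightly larger than the hull of its points, by a margin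
  that grows with its level, so that no two blocks overlap.\<close>

definition block_margin :: "nat \<Rightarrow> real" where
  "block_margin a = 1 / 2 - 1 / (real a + 3)"

fun left_end :: "nat + nat \<times> nat \<Rightarrow> real" where
  "left_end (Inl i) = - real i - 1"
| "left_end (Inr (a, s)) = real s - block_margin a"

fun right_end :: "nat + nat \<times> nat \<Rightarrow> real" where
  "right_end (Inl i) = real i"
| "right_end (Inr (a, s)) = real (s + 2 ^ a) - 1 + block_margin a"

text \<open>A margin below 1/2 captures no further integer; a positive one makes level 0 a proper
  interval, hence the offset 3 in the denominator.\<close>

lemma block_margin_bounds: "0 < block_margin a" "block_margin a < 1 / 2"
  by (simp_all add: block_margin_def field_simps)

lemma block_margin_strict_mono: "a < b \<Longrightarrow> block_margin a < block_margin b"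
  by (simp add: block_margin_def frac_less2)

lemma left_end_less_right_end: "left_end x < right_end x"
proof (cases x)
  case (Inr y)
  obtain a s where "y = (a, s)" by (cases y)
  moreover have "(0::real) \<le> 2 ^ a - 1" by simp
  ultimately show ?thesis
    using Inr add_pos_nonneg[of "2 * block_margin a" "2 ^ a - 1"] block_margin_bounds(1)[of a]
    by simp
qed simp

text \<open>Points start at or left of -1 and blocks right of -1/2, so they overlap iff the right
  endpoint \<open>i\<close> lies in the interval of the block.\<close>

lemma point_overlaps_block_iff:
  "overlap (left_end (Inl i)) (right_end (Inl i)) (left_end (Inr (a, s))) (right_end (Inr (a, s)))
    \<longleftrightarrow> i \<in> {s..<s + 2 ^ a}"
proof -
  have "real s - block_margin a \<le> real i \<longleftrightarrow> s \<le> i"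
    using block_margin_bounds[of a] by linarith
  moreover have "real i \<le> real (s + 2 ^ a) - 1 + block_margin a \<longleftrightarrow> i < s + 2 ^ a"
    using block_margin_bounds[of a] by linarith
  moreover have "- real i - 1 < real s - block_margin a"
    using block_margin_bounds[of a] by linarith
  ultimately show ?thesis by (auto simp: overlap_def)
qed

text \<open>Disjoint blocks stay apart since two margins sum to less than 1. For nested blocks the
  smaller margin of the inner one makes the inclusion strict at both ends.\<close>

lemma blocks_not_overlap:
  assumes "(b, t) \<in> dyadic_blocks a s" "(b', t') \<in> dyadic_blocks a s" "(b, t) \<noteq> (b', t')"
  shows "\<not> overlap (left_end (Inr (b, t))) (right_end (Inr (b, t)))
    (left_end (Inr (b', t'))) (right_end (Inr (b', t')))"
proof -
  consider "t + 2 ^ b \<le> t'" | "t' + 2 ^ b' \<le> t"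
    | "b < b'" "t' \<le> t" "t + 2 ^ b \<le> t' + 2 ^ b'"
    | "b' < b" "t \<le> t'" "t' + 2 ^ b' \<le> t + 2 ^ b"
    using dyadic_blocks_laminar[OF assms] by blast
  then show ?thesis
    using block_margin_bounds[of b] block_margin_bounds[of b']
      block_margin_strict_mono[of b b'] block_margin_strict_mono[of b' b]
    unfolding overlap_def left_end.simps right_end.simps by cases linarith+
qed

lemma max_cf_circle_lower_bound:
  assumes "3 * 2 ^ k \<le> n"
  shows "k < max_cf_circle n"
proof -
  define V where "V = {..<(2::nat) ^ k} <+> dyadic_blocks k 0"
  define E where "E = overlap_edges V left_end right_end"
  have fin: "finite V" by (simp add: V_def finite_dyadic_blocks)
  have "card V \<le> n"
    using assms card_dyadic_blocks[of k 0] by (simp add: V_def card_Plus finite_dyadic_blocks)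
  moreover have "circle_graph V E"
    unfolding E_def by (intro circle_graph_overlap_edges fin left_end_less_right_end)
  ultimately have "cf_chromatic V E \<le> max_cf_circle n"
    by (intro cf_chromatic_le_max_cf_circle)
  moreover have "k < cf_chromatic V E"
  proof -
    obtain c where c: "cf_coloring V E c" "card (c ` V) = cf_chromatic V E"
      using cf_coloring_attains_chromatic[OF fin] by blast
    have nb: "punctured_nbhd V E (Inr (b, t)) = Inl ` {t..<t + 2 ^ b}"
      if "(b, t) \<in> dyadic_blocks k 0" for b t
    proof (intro set_eqI)
      fix u
      show "u \<in> punctured_nbhd V E (Inr (b, t)) \<longleftrightarrow> u \<in> Inl ` {t..<t + 2 ^ b}"
      proof (cases u)
        case (Inl i)
        have "i < 2 ^ k" if "i < t + 2 ^ b"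
          using that dyadic_blocks_bounds[OF \<open>(b, t) \<in> dyadic_blocks k 0\<close>] by linarith
        then show ?thesis
          using that point_overlaps_block_iff[of i b t]
          unfolding Inl punctured_nbhd_def E_def mem_Collect_eq overlap_edges_iff
          by (auto simp: V_def simp del: left_end.simps right_end.simps)
      next
        case (Inr y)
        obtain b' t' where y: "y = (b', t')" by (cases y)
        show ?thesis
          using that blocks_not_overlap[of b' t' k 0 b t]
          unfolding Inr y punctured_nbhd_def E_def overlap_edges_iff by (auto simp: V_def)
      qed
    qed
    have "\<exists>i. card ({t..<t + 2 ^ b} \<inter> (c \<circ> Inl) -` {i}) = 1"
      if bt: "(b, t) \<in> dyadic_blocks k 0" for b t
    proof -
      have "Inr (b, t) \<in> V" using bt by (auto simp: V_def)
      moreover have "punctured_nbhd V E (Inr (b, t)) \<noteq> {}" by (simp add: nb[OF bt])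
      ultimately obtain i where "card (Inl ` {t..<t + 2 ^ b} \<inter> c -` {i}) = 1"
        using c(1) unfolding cf_coloring_def by (metis nb[OF bt])
      moreover have "Inl ` {t..<t + 2 ^ b} \<inter> c -` {i} =
          Inl ` ({t..<t + 2 ^ b} \<inter> (c \<circ> Inl) -` {i})"
        by auto
      ultimately show ?thesis by (metis card_image inj_Inl)
    qed
    then have "k < card ((c \<circ> Inl) ` {0..<0 + 2 ^ k})"
      by (rule dyadic_coloring_many_colors)
    also have "\<dots> \<le> card (c ` V)"
      using fin by (intro card_mono) (auto simp: V_def)
    finally show ?thesis using c(2) by simp
  qed
  ultimately show ?thesis by simp
qed

section \<open>Conflict-free colourings for endpoints in an interval\<close>

text \<open>Greedy choice: take any \<open>x\<close>, discard it with its at most \<open>d\<close>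
  neighbours, and recurse on the rest.\<close>

lemma bounded_degree_independent_set:
  fixes N :: "'a \<Rightarrow> 'a set"
  assumes "finite Y" "\<And>x. x \<in> Y \<Longrightarrow> finite (N x) \<and> card (N x) \<le> d"
    and "\<And>x y. y \<in> N x \<Longrightarrow> x \<in> N y"
  shows "\<exists>I\<subseteq>Y. card Y \<le> Suc d * card I \<and> (\<forall>x\<in>I. \<forall>y\<in>I. x \<noteq> y \<longrightarrow> y \<notin> N x)"
  using assms(1,2)
proof (induction Y rule: finite_psubset_induct)
  case (psubset Y)
  show ?case
  proof (cases "Y = {}")
    case False
    then obtain x where x: "x \<in> Y" by blast
    define Z where "Z = Y - insert x (N x)"
    have fin: "finite (N x)" and deg: "card (N x) \<le> d" using psubset.prems x by auto
    have "Z \<subset> Y" using x by (auto simp: Z_def)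
    then obtain I where I: "I \<subseteq> Z" "card Z \<le> Suc d * card I"
        "\<forall>x\<in>I. \<forall>y\<in>I. x \<noteq> y \<longrightarrow> y \<notin> N x"
      using psubset.IH[of Z] psubset.prems by blast
    have finI: "finite I"
      using I(1) \<open>Z \<subset> Y\<close> psubset.hyps by (meson finite_subset psubset_imp_subset)
    have "Y \<subseteq> Z \<union> insert x (N x)" by (auto simp: Z_def)
    then have "card Y \<le> card (Z \<union> insert x (N x))"
      using psubset.hyps fin by (intro card_mono) (auto simp: Z_def)
    also have "\<dots> \<le> card Z + card (insert x (N x))" by (rule card_Un_le)
    also have "card (insert x (N x)) \<le> Suc d" using fin deg by (simp add: card_insert_if)
    also have "x \<notin> I" using I(1) by (auto simp: Z_def)
    then have "card Z + Suc d \<le> Suc d * card (insert x I)" using I(2) finI by simp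
    finally have "card Y \<le> Suc d * card (insert x I)" by simp
    moreover have "insert x I \<subseteq> Y" using x I(1) by (auto simp: Z_def)
    moreover have "\<forall>u\<in>insert x I. \<forall>v\<in>insert x I. u \<noteq> v \<longrightarrow> v \<notin> N u"
      using I(1,3) assms(3) by (auto simp: Z_def)
    ultimately show ?thesis by blast
  qed auto
qed

definition hits :: "('a \<Rightarrow> real) \<Rightarrow> ('a \<Rightarrow> real) \<Rightarrow> real \<Rightarrow> real \<Rightarrow> 'a \<Rightarrow> bool" where
  "hits l r a b x \<longleftrightarrow> l x \<in> {a..b} \<or> r x \<in> {a..b}"

text \<open>List all endpoints from left to right and join two elements of \<open>Y\<close> if they own
  consecutive entries. An interval meets the list in a contiguous piece, so if all owners there
  belong to an independent set they coincide.\<close>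

lemma endpoint_independent_set:
  fixes l r :: "'a \<Rightarrow> real"
  assumes "finite Y"
  obtains I where "I \<subseteq> Y" "card Y \<le> 5 * card I"
    "\<And>a b x y. x \<in> I \<Longrightarrow> y \<in> I \<Longrightarrow> x \<noteq> y \<Longrightarrow> hits l r a b x \<Longrightarrow> hits l r a b y
      \<Longrightarrow> \<exists>z\<in>Y - I. hits l r a b z"
proof -
  \<comment> \<open>\<open>(x, False)\<close> is the left and \<open>(x, True)\<close> the right
    endpoint of \<open>x\<close>; as pairs, endpoints of equal value remain separate
    entries.\<close>
  define pos where "pos p = (if snd p then r (fst p) else l (fst p))" for p :: "'a \<times> bool"
  obtain xs where xs: "set xs = Y \<times> (UNIV :: bool set)" "distinct xs"
    using finite_distinct_list[of "Y \<times> (UNIV :: bool set)"] assms by auto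
  define qs where "qs = sort_key pos xs"
  define n where "n = length qs"
  define owner where "owner i = fst (qs ! i)" for i
  have qs: "set qs = Y \<times> UNIV" "distinct qs" "sorted (map pos qs)"
    using xs by (simp_all add: qs_def)
  have mono: "pos (qs ! i) \<le> pos (qs ! j)" if "i \<le> j" "j < n" for i j
    using sorted_nth_mono[OF qs(3), of i j] that by (simp add: n_def)
  have "\<forall>p\<in>set qs. \<exists>i<n. qs ! i = p" by (simp add: in_set_conv_nth n_def)
  then obtain idx where idx: "\<And>p. p \<in> set qs \<Longrightarrow> idx p < n \<and> qs ! idx p = p" by metis
  have idx_nth: "idx (qs ! i) = i" if "i < n" for i
    using idx[of "qs ! i"] that nth_eq_iff_index_eq[OF qs(2), of "idx (qs ! i)" i]
    by (simp add: n_def)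
  have owner_Y: "owner i \<in> Y" if "i < n" for i
    using nth_mem[of i qs] that qs(1) by (auto simp: n_def owner_def)
  define N where "N x = {owner j | i j. i < n \<and> j < n \<and> owner i = x \<and> (j = Suc i \<or> i = Suc j)}"
    for x
  have "finite (N x) \<and> card (N x) \<le> 4" for x
  proof -
    let ?p = "idx (x, False)" and ?q = "idx (x, True)"
    \<comment> \<open>\<open>x\<close> owns two entries with at most two list neighbours each. At
      the ends of the list \<open>- 1\<close> truncates or \<open>Suc\<close> overshoots; spurious
      values are harmless in a superset.\<close>
    have sub: "N x \<subseteq> set (map owner [Suc ?p, ?p - 1, Suc ?q, ?q - 1])"
    proof
      fix y assume "y \<in> N x"
      then obtain i j where ij: "y = owner j" "i < n" "owner i = x" "j = Suc i \<or> i = Suc j"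
        unfolding N_def by blast
      have "qs ! i = (x, False) \<or> qs ! i = (x, True)"
        using ij(3) by (cases "qs ! i") (auto simp: owner_def)
      then have "i = ?p \<or> i = ?q" using idx_nth[OF ij(2)] by auto
      then show "y \<in> set (map owner [Suc ?p, ?p - 1, Suc ?q, ?q - 1])" using ij(1,4) by auto
    qed
    then have "card (N x) \<le> card (set (map owner [Suc ?p, ?p - 1, Suc ?q, ?q - 1]))"
      by (intro card_mono) auto
    also have "\<dots> \<le> 4" by (rule order_trans[OF card_length]) simp
    finally show ?thesis using sub finite_subset by blast
  qed
  moreover have "\<And>x y. y \<in> N x \<Longrightarrow> x \<in> N y" unfolding N_def by blast
  ultimately obtain I where I: "I \<subseteq> Y" "card Y \<le> Suc 4 * card I"
      "\<forall>x\<in>I. \<forall>y\<in>I. x \<noteq> y \<longrightarrow> y \<notin> N x"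
    using bounded_degree_independent_set[OF assms, of N 4] by blast
  have hits_owner: "hits l r a b (owner i)" if "a \<le> pos (qs ! i)" "pos (qs ! i) \<le> b" for a b i
    using that by (auto simp: hits_def pos_def owner_def split: if_splits)
  \<comment> \<open>From \<open>i\<close> to \<open>j\<close> every entry lies in the query
    interval, so its owner hits it and must be in \<open>I\<close>; distinct consecutive owners
    would be joined, against independence.\<close>
  have same_owner: "owner j = owner i"
    if "i \<le> j" "j < n" "owner i \<in> I" "a \<le> pos (qs ! i)" "pos (qs ! j) \<le> b"
      and none: "\<not> (\<exists>z\<in>Y - I. hits l r a b z)" for i j a b
    using that(1,2,5)
  proof (induction j rule: dec_induct)
    case (step k)
    have "owner k = owner i"
      using step mono[of k "Suc k"] by simp
    have "hits l r a b (owner (Suc k))"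
      using step that(4) mono[of i "Suc k"] by (intro hits_owner) auto
    then have "owner (Suc k) \<in> I" using none owner_Y step.prems(1) by blast
    moreover have "owner (Suc k) \<in> N (owner k)" 
      unfolding N_def using step.prems(1) Suc_lessD by blast
    ultimately show ?case using I(3) \<open>owner k = owner i\<close> that(3) by metis
  qed simp
  have "\<exists>z\<in>Y - I. hits l r a b z"
    if xy: "x \<in> I" "y \<in> I" "x \<noteq> y" "hits l r a b x" "hits l r a b y" for a b x y
  proof (rule ccontr)
    assume none: "\<not> (\<exists>z\<in>Y - I. hits l r a b z)"
    have index: "\<exists>i<n. owner i = u \<and> a \<le> pos (qs ! i) \<and> pos (qs ! i) \<le> b"
      if u: "u \<in> I" "hits l r a b u" for u
    proof -
      have "\<exists>s. a \<le> pos (u, s) \<and> pos (u, s) \<le> b"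
        using u(2) by (simp add: hits_def pos_def) (metis (full_types))
      then obtain s where s: "a \<le> pos (u, s)" "pos (u, s) \<le> b" by blast
      have "(u, s) \<in> set qs" using u(1) I(1) qs(1) by auto
      then show ?thesis
        using idx[of "(u, s)"] s by (intro exI[of _ "idx (u, s)"]) (auto simp: owner_def)
    qed
    obtain i where i: "i < n" "owner i = x" "a \<le> pos (qs ! i)" "pos (qs ! i) \<le> b"
      using index xy by blast
    obtain j where j: "j < n" "owner j = y" "a \<le> pos (qs ! j)" "pos (qs ! j) \<le> b"
      using index xy by blast
    show False
      using same_owner[of i j a b] same_owner[of j i a b] i j xy none
      by (cases i j rule: linorder_le_cases) auto
  qed
  with I that[of I] show ?thesis by simp
qed

text \<open>Each round spends one colour on at least a fifth of the remaining elements; by the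
  hypothesis, \<open>K\<close> rounds leave none.\<close>

lemma interval_hitting_coloring:
  fixes l r :: "'a \<Rightarrow> real"
  assumes "finite X" "real (card X) * (4 / 5) ^ K < 1"
  shows "\<exists>c :: 'a \<Rightarrow> nat. (\<forall>x\<in>X. c x < K) \<and>
    (\<forall>a b. (\<exists>x\<in>X. hits l r a b x) \<longrightarrow> (\<exists>i. card {x\<in>X. hits l r a b x \<and> c x = i} = 1))"
  using assms
proof (induction K arbitrary: X)
  case 0
  then have "X = {}" by simp
  then show ?case by simp
next
  case (Suc K)
  obtain I where I: "I \<subseteq> X" "card X \<le> 5 * card I"
    and indep: "\<And>a b x y. x \<in> I \<Longrightarrow> y \<in> I \<Longrightarrow> x \<noteq> y \<Longrightarrow> hits l r a b x \<Longrightarrow> hits l r a b y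
      \<Longrightarrow> \<exists>z\<in>X - I. hits l r a b z"
    using endpoint_independent_set[OF Suc.prems(1), of l r] by blast
  have finI: "finite I" using I(1) Suc.prems(1) finite_subset by blast
  have "real (card (X - I)) = real (card X) - real (card I)"
    using I(1) finI Suc.prems(1) by (simp add: card_Diff_subset card_mono of_nat_diff)
  then have "real (card (X - I)) \<le> real (card X) * (4 / 5)" using I(2) by linarith
  then have "real (card (X - I)) * (4 / 5) ^ K \<le> real (card X) * (4 / 5) * (4 / 5) ^ K"
    by (intro mult_right_mono) auto
  also have "\<dots> < 1" using Suc.prems(2) by (simp add: mult.assoc)
  finally obtain c :: "'a \<Rightarrow> nat" where c: "\<And>x. x \<in> X - I \<Longrightarrow> c x < K"
    and cf: "\<And>a b. \<exists>x\<in>X - I. hits l r a b x \<Longrightarrow>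
      \<exists>i. card {x\<in>X - I. hits l r a b x \<and> c x = i} = 1"
    using Suc.IH[of "X - I"] Suc.prems(1) by (metis finite_Diff)
  define c' where "c' x = (if x \<in> I then K else c x)" for x
  have "\<exists>i. card {x\<in>X. hits l r a b x \<and> c' x = i} = 1" if ex: "\<exists>x\<in>X. hits l r a b x" for a b
  \<comment> \<open>A query hitting the rest is served by the recursion, which avoids colour
    \<open>K\<close>. Any other query hits exactly one element of \<open>I\<close>, as two would
    force a hit outside \<open>I\<close>.\<close>
  proof (cases "\<exists>x\<in>X - I. hits l r a b x")
    case True
    then obtain i where i: "card {x\<in>X - I. hits l r a b x \<and> c x = i} = 1" using cf by blast
    then have "{x\<in>X - I. hits l r a b x \<and> c x = i} \<noteq> {}" by (metis card.empty zero_neq_one)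
    then have "i < K" using c by blast
    then have "{x\<in>X. hits l r a b x \<and> c' x = i} = {x\<in>X - I. hits l r a b x \<and> c x = i}"
      by (auto simp: c'_def)
    with i show ?thesis by metis
  next
    case False
    then obtain x where x: "x \<in> I" "hits l r a b x" using ex by blast
    have "y = x" if "y \<in> X" "hits l r a b y" for y
      using False that x indep by blast
    then have "{y\<in>X. hits l r a b y \<and> c' y = K} = {x}"
      using x I(1) by (auto simp: c'_def)
    then show ?thesis by (intro exI[of _ K]) simp
  qed
  moreover have "\<forall>x\<in>X. c' x < Suc K" using c by (auto simp: c'_def less_Suc_eq)
  ultimately show ?case by blast
qed

section \<open>Breadth-first layers of an overlap graph\<close>

text \<open>An overlap puts \<open>a\<close> or \<open>b\<close> between \<open>c\<close> and
  \<open>d\<close>, hence strictly between \<open>s\<close> and \<open>t\<close>; the other endpoint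
  cannot lie outside without an overlap.\<close>

lemma strictly_inside_propagates:
  assumes "overlap a b c d" "\<not> overlap a b s t" "s < c" "d < t"
  shows "s < a \<and> b < t"
  using assms unfolding overlap_def by linarith

locale overlap_graph =
  fixes V :: "'a set" and l r :: "'a \<Rightarrow> real"
  assumes finite_V: "finite V" and l_less_r: "v \<in> V \<Longrightarrow> l v < r v"
begin

definition adj :: "('a \<times> 'a) set" where
  "adj = {(u, v). {u, v} \<in> overlap_edges V l r}"

definition component :: "'a \<Rightarrow> 'a set" where
  "component v = adj\<^sup>* `` {v}"

text \<open>The left endpoint of the root is minimal, so the root never lies inside another interval
  of its component.\<close>

definition root :: "'a \<Rightarrow> 'a" where
  "root v = arg_min_on l (component v)"

definition depth :: "'a \<Rightarrow> nat" where
  "depth v = (LEAST n. (root v, v) \<in> adj ^^ n)"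

lemma adj_iff: "(u, v) \<in> adj \<longleftrightarrow> u \<in> V \<and> v \<in> V \<and> u \<noteq> v \<and> overlap (l u) (r u) (l v) (r v)"
  by (simp add: adj_def overlap_edges_iff)

lemma sym_adj: "sym adj"
  by (auto intro: symI simp: adj_def insert_commute)

lemma component_eq:
  assumes "(u, v) \<in> adj\<^sup>*"
  shows "component u = component v"
proof -
  have "(v, u) \<in> adj\<^sup>*" using assms sym_rtrancl[OF sym_adj] by (meson symE)
  with assms show ?thesis unfolding component_def by (auto intro: rtrancl_trans)
qed

lemma root_eq: "(u, v) \<in> adj\<^sup>* \<Longrightarrow> root u = root v"
  unfolding root_def using component_eq by metis

lemma root_adj: "(u, v) \<in> adj \<Longrightarrow> root u = root v"
  using root_eq by blast

lemma finite_component: "finite (component v)"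
proof (rule finite_subset)
  \<comment> \<open>The reflexive closure puts \<open>v\<close> into its component even if
    \<open>v\<close> is not in \<open>V\<close>.\<close>
  have "w \<in> insert v V" if "(v, w) \<in> adj\<^sup>*" for w
    using that by induction (auto simp: adj_iff)
  then show "component v \<subseteq> insert v V" by (auto simp: component_def)
qed (simp add: finite_V)

lemma root_connected: "(v, root v) \<in> adj\<^sup>*"
  and l_root_le: "l (root v) \<le> l v"
proof -
  have "v \<in> component v" by (simp add: component_def)
  then show "(v, root v) \<in> adj\<^sup>*" "l (root v) \<le> l v"
    using arg_min_if_finite[OF finite_component[of v], of l]
    unfolding root_def by (force simp: component_def)+
qed

lemma depth_path: "(root v, v) \<in> adj ^^ depth v"
proof -
  have "(root v, v) \<in> adj\<^sup>*"
    using root_connected sym_rtrancl[OF sym_adj] by (meson symE)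
  then have "\<exists>n. (root v, v) \<in> adj ^^ n" by (simp only: rtrancl_power)
  then show ?thesis unfolding depth_def by (rule LeastI_ex)
qed

lemma depth_le: "(root v, v) \<in> adj ^^ n \<Longrightarrow> depth v \<le> n"
  unfolding depth_def by (rule Least_le)

lemma depth_0_iff: "depth v = 0 \<longleftrightarrow> root v = v"
  using depth_path[of v] depth_le[of v 0] by auto

lemma depth_adj: "(u, v) \<in> adj \<Longrightarrow> depth v \<le> Suc (depth u)"
  using depth_path[of u] root_adj[of u v] by (intro depth_le) auto

lemma depth_parent:
  assumes "depth v = Suc n"
  obtains u where "(u, v) \<in> adj" "root u = root v" "depth u = n"
proof -
  have "(root v, v) \<in> adj ^^ Suc n" using depth_path[of v] assms by simp
  then obtain u where u: "(root v, u) \<in> adj ^^ n" "(u, v) \<in> adj" by (rule relpow_Suc_E)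
  have "root u = root v" using root_adj u(2) .
  moreover have "depth u \<le> n" using depth_le u(1) calculation by simp
  moreover have "n \<le> depth u" using depth_adj[OF u(2)] assms by simp
  ultimately show ?thesis using that u(2) by simp
qed

text \<open>Induction along a shortest path from the root. If \<open>y\<close> were inside
  \<open>v\<close>, so would be its parent \<open>u\<close>, which is too shallow to be adjacent to
  \<open>v\<close>; at the root this contradicts the minimal left endpoint.\<close>

lemma not_inside_if_shallow:
  assumes "v \<in> V" "root y = root v" "Suc (depth y) < depth v"
  shows "\<not> (l v < l y \<and> r y < r v)"
  using assms(2,3)
proof (induction "depth y" arbitrary: y)
  case 0
  then have "y = root v" using depth_0_iff by simp
  then show ?case using l_root_le[of v] by simp
next
  case (Suc n)
  obtain u where u: "(u, y) \<in> adj" "root u = root y" "depth u = n"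
    using depth_parent Suc.hyps(2) by metis
  have "\<not> (l v < l u \<and> r u < r v)"
    using Suc.hyps(1)[of u] u Suc.prems Suc.hyps(2) by simp
  moreover have "\<not> overlap (l u) (r u) (l v) (r v)"
  proof
    assume "overlap (l u) (r u) (l v) (r v)"
    moreover have "u \<noteq> v" using u(3) Suc.hyps(2) Suc.prems(2) by auto
    ultimately have "(u, v) \<in> adj" using u(1) assms(1) by (simp add: adj_iff)
    then show False using depth_adj[of u v] u(3) Suc.hyps(2) Suc.prems(2) by simp
  qed
  moreover have "overlap (l u) (r u) (l y) (r y)" using u(1) by (simp add: adj_iff)
  ultimately show ?case using strictly_inside_propagates by blast
qed

text \<open>The parent \<open>y\<close> of \<open>x\<close>, which exists as \<open>x\<close> has
  positive depth, is two layers before \<open>v\<close>, so it neither overlaps \<open>v\<close> nor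
  lies inside it. Hence \<open>x\<close> is not strictly inside \<open>v\<close>, and an endpoint of
  \<open>x\<close> in \<open>v\<close> means overlap.\<close>

lemma adj_iff_hits:
  assumes "x \<in> V" "v \<in> V" "root x = root v" "0 < depth x" "depth v = Suc (depth x)"
  shows "(x, v) \<in> adj \<longleftrightarrow> hits l r (l v) (r v) x"
proof
  assume "(x, v) \<in> adj"
  then show "hits l r (l v) (r v) x" by (auto simp: adj_iff overlap_def hits_def)
next
  assume hit: "hits l r (l v) (r v) x"
  obtain n where n: "depth x = Suc n" using assms(4) gr0_implies_Suc by blast
  then obtain y where y: "(y, x) \<in> adj" "root y = root x" "depth y = n"
    by (rule depth_parent)
  have "\<not> overlap (l y) (r y) (l v) (r v)"
  proof
    assume "overlap (l y) (r y) (l v) (r v)"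
    moreover have "y \<noteq> v" using y(3) n assms(5) by auto
    ultimately have "(y, v) \<in> adj" using y(1) assms(2) by (simp add: adj_iff)
    then show False using depth_adj[of y v] y(3) n assms(5) by simp
  qed
  moreover have "overlap (l y) (r y) (l x) (r x)" using y(1) by (simp add: adj_iff)
  moreover have "\<not> (l v < l y \<and> r y < r v)"
    using not_inside_if_shallow[of v y] y assms n by simp
  ultimately have "\<not> (l v < l x \<and> r x < r v)" using strictly_inside_propagates by blast
  then have "overlap (l x) (r x) (l v) (r v)"
    using hit l_less_r[OF assms(1)] l_less_r[OF assms(2)]
    unfolding hits_def overlap_def atLeastAtMost_iff by linarith
  moreover have "x \<noteq> v" using assms(5) by auto
  ultimately show "(x, v) \<in> adj" using assms(1,2) by (simp add: adj_iff)
qed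

section \<open>The colouring by layers\<close>

lemma punctured_nbhd_eq: "punctured_nbhd V (overlap_edges V l r) v = {u. (u, v) \<in> adj}"
  by (auto simp: punctured_nbhd_def adj_iff overlap_edges_iff)

lemma cf_coloring_exists:
  assumes K: "real (card V) * (4 / 5) ^ K < 1"
  shows "\<exists>c. cf_coloring V (overlap_edges V l r) c \<and> card (c ` V) \<le> 3 * K"
proof -
  \<comment> \<open>Different components may share colours, as all neighbours of a vertex lie in its
    component.\<close>
  define X where "X \<rho> i = {x \<in> V. root x = \<rho> \<and> depth x = i}" for \<rho> i
  have "\<exists>c :: 'a \<Rightarrow> nat. (\<forall>x\<in>X \<rho> i. c x < K) \<and>
    (\<forall>a b. (\<exists>x\<in>X \<rho> i. hits l r a b x) \<longrightarrow>
      (\<exists>m. card {x\<in>X \<rho> i. hits l r a b x \<and> c x = m} = 1))" for \<rho> i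
  proof (rule interval_hitting_coloring)
    show "finite (X \<rho> i)" by (simp add: X_def finite_V)
    have "card (X \<rho> i) \<le> card V" by (intro card_mono finite_V) (auto simp: X_def)
    then have "real (card (X \<rho> i)) * (4 / 5) ^ K \<le> real (card V) * (4 / 5) ^ K"
      by (intro mult_right_mono) auto
    with K show "real (card (X \<rho> i)) * (4 / 5) ^ K < 1" by linarith
  qed
  then obtain C :: "'a \<Rightarrow> nat \<Rightarrow> 'a \<Rightarrow> nat" where C_less: "\<And>\<rho> i x. x \<in> X \<rho> i \<Longrightarrow> C \<rho> i x < K"
    and C_cf: "\<And>\<rho> i a b. \<exists>x\<in>X \<rho> i. hits l r a b x \<Longrightarrow>
      \<exists>m. card {x\<in>X \<rho> i. hits l r a b x \<and> C \<rho> i x = m} = 1"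
    by metis
  \<comment> \<open>The residue encodes the palette: neighbours of a vertex in layer
    \<open>i + 1\<close> lie in layers \<open>i\<close> to \<open>i + 2\<close>, so the residue of
    \<open>i\<close> singles out layer \<open>i\<close>.\<close>
  define c where "c v = 3 * C (root v) (depth v) v + depth v mod 3" for v
  have "c ` V \<subseteq> {..<3 * K}"
  proof clarify
    fix v assume "v \<in> V"
    then have "C (root v) (depth v) v < K" by (intro C_less) (simp add: X_def)
    moreover have "depth v mod 3 < 3" by simp
    ultimately show "c v < 3 * K" unfolding c_def by linarith
  qed
  then have "card (c ` V) \<le> 3 * K" using card_mono[of "{..<3 * K}" "c ` V"] by simp
  moreover have "\<exists>k. card ({u. (u, v) \<in> adj} \<inter> c -` {k}) = 1"
    if v: "v \<in> V" and ne: "{u. (u, v) \<in> adj} \<noteq> {}" for v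
  proof (cases "depth v")
    \<comment> \<open>A root has no earlier layer; its neighbourhood is all of layer 1.\<close>
    case 0
    have nb: "u \<in> X v 1" if "(u, v) \<in> adj" for u
    proof -
      have ru: "root u = v" using root_adj[OF that] 0 depth_0_iff by simp
      then have "depth u \<noteq> 0" using that depth_0_iff by (auto simp: adj_iff)
      moreover have "(v, u) \<in> adj" using that sym_adj by (meson symE)
      then have "depth u \<le> 1" using depth_adj[of v u] 0 by simp
      ultimately show ?thesis using that ru by (auto simp: X_def adj_iff)
    qed
    have nb': "(u, v) \<in> adj" if "u \<in> X v 1" for u
    proof -
      have u: "depth u = Suc 0" "root u = v" using that by (simp_all add: X_def)
      then obtain w where "(w, u) \<in> adj" "root w = root u" "depth w = 0"
        by (metis depth_parent)
      then have "(v, u) \<in> adj" using depth_0_iff u(2) by metis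
      then show ?thesis using sym_adj by (meson symE)
    qed
    \<comment> \<open>This interval contains all left endpoints, so the whole layer hits it.\<close>
    define a b where "a = Min (l ` V)" and "b = Max (l ` V)"
    have hit: "hits l r a b x" if "x \<in> V" for x
      using that finite_V by (simp add: hits_def a_def b_def)
    obtain u where "(u, v) \<in> adj" using ne by blast
    then have "\<exists>x\<in>X v 1. hits l r a b x" using nb hit adj_iff by blast
    then obtain m where m: "card {x\<in>X v 1. hits l r a b x \<and> C v 1 x = m} = 1"
      using C_cf by blast
    have "{u. (u, v) \<in> adj} \<inter> c -` {3 * m + 1} = {x\<in>X v 1. hits l r a b x \<and> C v 1 x = m}"
    proof (intro equalityI subsetI)
      fix x assume "x \<in> {u. (u, v) \<in> adj} \<inter> c -` {3 * m + 1}"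
      then have "(x, v) \<in> adj" "c x = 3 * m + 1" by auto
      then show "x \<in> {x\<in>X v 1. hits l r a b x \<and> C v 1 x = m}"
        using nb[of x] hit by (auto simp: X_def c_def)
    next
      fix x assume "x \<in> {x\<in>X v 1. hits l r a b x \<and> C v 1 x = m}"
      then show "x \<in> {u. (u, v) \<in> adj} \<inter> c -` {3 * m + 1}"
        using nb'[of x] by (auto simp: X_def c_def)
    qed
    with m show ?thesis by (intro exI[of _ "3 * m + 1"]) (simp only:)
  next
    case (Suc i)
    define S where "S = {x \<in> X (root v) i. (x, v) \<in> adj}"
    have parent: "S \<noteq> {}"
    proof -
      obtain u where "(u, v) \<in> adj" "root u = root v" "depth u = i" using depth_parent[OF Suc] .
      then have "u \<in> S" by (simp add: S_def X_def adj_iff)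
      then show ?thesis by blast
    qed
    have "\<exists>m. card {x\<in>S. C (root v) i x = m} = 1"
    proof (cases "i = 0")
      \<comment> \<open>Layer 0 is the root alone; \<open>adj_iff_hits\<close> needs positive
        depth.\<close>
      case True
      have "S \<subseteq> {root v}" using True depth_0_iff by (auto simp: S_def X_def)
      with parent have "S = {root v}" by blast
      then have "{x\<in>S. C (root v) i x = C (root v) i (root v)} = {root v}" by auto
      then show ?thesis by (intro exI[of _ "C (root v) i (root v)"]) simp
    next
      case False
      have S: "S = {x \<in> X (root v) i. hits l r (l v) (r v) x}"
        unfolding S_def using adj_iff_hits[of _ v] v Suc False by (auto simp: X_def)
      then have "\<exists>x\<in>X (root v) i. hits l r (l v) (r v) x" using parent by blast
      then obtain m where "card {x\<in>X (root v) i. hits l r (l v) (r v) x \<and> C (root v) i x = m} = 1"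
        using C_cf by blast
      moreover have "{x\<in>X (root v) i. hits l r (l v) (r v) x \<and> C (root v) i x = m} =
          {x\<in>S. C (root v) i x = m}"
        unfolding S by blast
      ultimately show ?thesis by (intro exI[of _ m]) (simp only:)
    qed
    then obtain m where m: "card {x\<in>S. C (root v) i x = m} = 1" by blast
    have "{u. (u, v) \<in> adj} \<inter> c -` {3 * m + i mod 3} = {x\<in>S. C (root v) i x = m}"
    proof (intro equalityI subsetI)
      fix x assume "x \<in> {u. (u, v) \<in> adj} \<inter> c -` {3 * m + i mod 3}"
      then have x: "(x, v) \<in> adj" "c x = 3 * m + i mod 3" by auto
      then have "(v, x) \<in> adj" using sym_adj by (meson symE)
      then have range: "i \<le> depth x" "depth x \<le> i + 2"
        using depth_adj[of x v] depth_adj[of v x] x(1) Suc by auto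
      have "p = m \<and> d = i" if eq: "3 * p + d mod 3 = 3 * m + i mod 3" and d: "i \<le> d" "d \<le> i + 2"
        for p d :: nat
      proof -
        have mod: "p = m" "d mod 3 = i mod 3" using eq by presburger+
        from mod(2) d have "d = i" by presburger
        with mod(1) show ?thesis by simp
      qed
      then have "C (root x) (depth x) x = m \<and> depth x = i"
        using x(2) range unfolding c_def by blast
      then show "x \<in> {x\<in>S. C (root v) i x = m}"
        using x(1) root_adj[OF x(1)] by (auto simp: S_def X_def adj_iff)
    next
      fix x assume "x \<in> {x\<in>S. C (root v) i x = m}"
      then show "x \<in> {u. (u, v) \<in> adj} \<inter> c -` {3 * m + i mod 3}"
        by (auto simp: S_def X_def c_def)
    qed
    with m show ?thesis by (intro exI[of _ "3 * m + i mod 3"]) (simp only:)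
  qed
  then have "cf_coloring V (overlap_edges V l r) c"
    unfolding cf_coloring_def punctured_nbhd_eq by blast
  ultimately show ?thesis by blast
qed

end

section \<open>The upper bound and the asymptotics\<close>

lemma cf_chromatic_le_if_cf_coloring: "cf_coloring V E c \<Longrightarrow> cf_chromatic V E \<le> card (c ` V)"
  unfolding cf_chromatic_def by (rule Least_le) blast

lemma max_cf_circle_upper_bound:
  assumes "real n * (4 / 5) ^ K < 1"
  shows "max_cf_circle n \<le> 3 * K"
  unfolding max_cf_circle_def
proof (rule Max.boundedI[OF finite_cf_values cf_values_nonempty], clarify)
  fix V :: "nat set" and E assume G: "circle_graph V E" and n: "card V \<le> n"
  obtain l r where lr: "\<And>v. v \<in> V \<Longrightarrow> l v < r v" and E: "E = overlap_edges V l r"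
    using circle_graph_imp_overlap_edges[OF G] by blast
  interpret overlap_graph V l r
    using G lr by unfold_locales (auto simp: circle_graph_def)
  have "real (card V) * (4 / 5) ^ K \<le> real n * (4 / 5) ^ K"
    using n by (intro mult_right_mono) auto
  with assms have "real (card V) * (4 / 5) ^ K < 1" by linarith
  then obtain c where "cf_coloring V E c" "card (c ` V) \<le> 3 * K"
    using cf_coloring_exists E by blast
  then show "cf_chromatic V E \<le> 3 * K"
    using cf_chromatic_le_if_cf_coloring le_trans by blast
qed

theorem theorem1:
  "(\<lambda>n. real (max_cf_circle n)) \<in> \<Theta>(\<lambda>n. ln (real n))"
proof (rule bigthetaI)
  \<comment> \<open>The 3 counts palettes, \<open>1 / ln (5 / 4)\<close> comes from the number
    \<open>K\<close> of rounds, and \<open>1 / ln 2\<close> absorbs the rounding in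
    \<open>K\<close>, as \<open>n\<close> is at least 2.\<close>
  define C where "C = 3 * (1 / ln (5 / 4) + 1 / ln 2 :: real)"
  have "real (max_cf_circle n) \<le> C * ln (real n)" if n: "n \<ge> 2" for n
  proof -
    define K where "K = Suc (nat \<lfloor>ln (real n) / ln (5 / 4)\<rfloor>)"
    have nonneg: "0 \<le> ln (real n) / ln (5 / 4)" using n by simp
    then have K: "ln (real n) / ln (5 / 4) < real K" "real K \<le> ln (real n) / ln (5 / 4) + 1"
      unfolding K_def by linarith+
    have "ln (real n) < real K * ln (5 / 4)" using K(1) by (simp add: divide_less_eq)
    then have "ln (real n) < ln ((5 / 4) ^ K)" by (simp add: ln_realpow)
    then have "real n < (5 / 4) ^ K" using n by simp
    then have "real n * (4 / 5) ^ K < (5 / 4) ^ K * (4 / 5) ^ K" by simp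
    also have "\<dots> = 1" by (simp flip: power_mult_distrib)
    finally have "max_cf_circle n \<le> 3 * K" by (rule max_cf_circle_upper_bound)
    then have "real (max_cf_circle n) \<le> 3 * real K"
      by (metis of_nat_le_iff of_nat_mult of_nat_numeral)
    also have "\<dots> \<le> 3 * (ln (real n) / ln (5 / 4) + ln (real n) / ln 2)"
    proof -
      have "1 \<le> ln (real n) / ln 2" using n by (simp add: le_divide_eq)
      then have "real K \<le> ln (real n) / ln (5 / 4) + ln (real n) / ln 2" using K(2) by linarith
      then show ?thesis by simp
    qed
    also have "\<dots> = C * ln (real n)" by (simp add: C_def algebra_simps)
    finally show ?thesis .
  qed
  then have "\<forall>\<^sub>F n in sequentially. norm (real (max_cf_circle n)) \<le> C * norm (ln (real n))"
    by (intro eventually_sequentiallyI[of 2]) simp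
  then show "(\<lambda>n. real (max_cf_circle n)) \<in> O(\<lambda>n. ln (real n))"
    by (rule bigoI)
next
  have "ln (real n) \<le> ln 6 * real (max_cf_circle n)" if n: "n \<ge> 3" for n
  proof -
    obtain k where k: "2 ^ k \<le> n div 3" "n div 3 < 2 ^ (k + 1)"
      using ex_power_ivl1[of 2 "n div 3"] n by (auto simp: div_greater_zero_iff Suc_le_eq)
    have lower: "3 * 2 ^ k \<le> n" using k(1) by linarith
    have upper: "n < 3 * 2 ^ (k + 1)" using k(2) by linarith
    \<comment> \<open>Enlarging the factor 3 to a power of 3 spares an additive constant after
      taking logarithms.\<close>
    have "3 * 2 ^ (k + 1) \<le> (6::nat) ^ (k + 1)"
    proof -
      have "3 * 2 ^ (k + 1) \<le> (3::nat) ^ (k + 1) * 2 ^ (k + 1)" by simp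
      then show ?thesis by (simp flip: power_mult_distrib)
    qed
    with upper have "n \<le> 6 ^ (k + 1)" by linarith
    then have "real n \<le> 6 ^ (k + 1)" by (metis of_nat_le_iff of_nat_numeral of_nat_power)
    then have "ln (real n) \<le> ln (6 ^ (k + 1))" using n by (intro ln_mono) auto
    also have "\<dots> = real (k + 1) * ln 6" by (rule ln_realpow)
    also have "\<dots> \<le> real (max_cf_circle n) * ln 6"
    proof (rule mult_right_mono)
      show "real (k + 1) \<le> real (max_cf_circle n)"
        using max_cf_circle_lower_bound[OF lower] by linarith
    qed simp
    finally show ?thesis by (simp only: mult.commute)
  qed
  then have "\<forall>\<^sub>F n in sequentially. norm (real (max_cf_circle n)) \<ge> 1 / ln 6 * norm (ln (real n))"
    by (intro eventually_sequentiallyI[of 3]) (simp add: divide_le_eq mult.commute[of "ln 6"])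
  then show "(\<lambda>n. real (max_cf_circle n)) \<in> \<Omega>(\<lambda>n. ln (real n))"
    by (rule landau_omega.bigI[rotated]) simp
qed

end
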